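(* Let $\mathbf A,\mathbf B\in\mathbb C^{N\times N}$, $\mathbf d\in\mathbb C^N$, $\mu\in\mathbb C$, and consider the shifted linear system $(\mathbf A-\mu\mathbf B)\mathbf y=\mathbf d$. Let $\sigma_0\in\mathbb C$, and assume that $m$ steps of rational Krylov (see context) have been performed on the pencil $(\mathbf A,\mathbf B)$ with shifts $\sigma_1,\dots,\sigma_m$ and starting vector $\mathbf v_1=\hat{\mathbf d}/\hat\beta$, where $\hat{\mathbf d}=(\mathbf A-\sigma_0\mathbf B)^{-1}\mathbf d$ and $\hat\beta=\|\hat{\mathbf d}\|$, so that $$\mathbf A\mathbf V_{m+1}\underline{H}_m=\mathbf B\mathbf V_{m+1}\underline{K}_m .$$ Let $y^{\mathrm{red}}_m=y^{\mathrm{red}}_m(\mu)\in\mathbb C^m$ solve the $(m+1)\times m$ least-squares problem $$y^{\mathrm{red}}_m=\arg\min_{y\in\mathbb C^m}\|\hat\beta e_1-(\underline K_m-\mu\underline H_m)y\| .$$ Then, among all vectors of the form $\mathbf V_{m+1}(\underline K_m-\sigma_0\underline H_m)y$ with $y\in\mathbb C^m$, the vector $\mathbf y_m(\mu)=\mathbf V_{m+1}(\underline K_m-\sigma_0\underline H_m)\,y^{\mathrm{red}}_m(\mu)$ minimizes the norm of the preconditioned residual, which for $\mathbf y_m$ is $$\mathbf r^{\sigma}_m(\mu):=(\mathbf A-\sigma_0\mathbf B)^{-1}\bigl(\mathbf d-(\mathbf A-\mu\mathbf B)\mathbf y_m\bigr),$$ and $\|\mathbf r^{\sigma}_m(\mu)\|=\|\hat\beta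 e_1-(\underline K_m-\mu\underline H_m)y^{\mathrm{red}}_m\|$.
   Context: $\|\cdot\|$ is the Euclidean norm and $e_1$ is the first standard unit vector (of length $m+1$). The matrices $\mathbf A-\sigma_i\mathbf B$, $i=0,\dots,m$, are invertible and $\hat{\mathbf d}\neq 0$. Rational Krylov: starting from a unit vector $\mathbf v_1$, in step $k=1,\dots,m$ one chooses a continuation vector $t_k\in\mathbb C^k$, computes $\mathbf w_k=(\mathbf A-\sigma_k\mathbf B)^{-1}\mathbf B\mathbf V_kt_k$ with $\mathbf V_k=[\mathbf v_1\cdots\mathbf v_k]$, and orthonormalizes $\mathbf w_k$ against $\mathbf V_k$, giving a new unit vector $\mathbf v_{k+1}$ such that $\mathbf V_{m+1}=[\mathbf v_1\cdots\mathbf v_{m+1}]$ has orthonormal columns and $[\mathbf w_1\cdots\mathbf w_m]=\mathbf V_{m+1}\underline H_m$ with $\underline H_m\in\mathbb C^{(m+1)\times m}$ upper Hessenberg. With $\Sigma_m=\mathrm{diag}(\sigma_1,\dots,\sigma_m)$ and $\underline T_m\in\mathbb C^{(m+1)\times m}$ the upper triangular matrix whose $k$-th column is $t_k$ padded with zeros, one sets $\underline K_m=\underline H_m\Sigma_m+\underline T_m$ (upper Hessenberg). This gives the recurrence $\mathbf A\mathbf V_{m+1}\underline H_m=\mathbf B\mathbf V_{m+1}\underline K_m$. *)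

theory Defs
  imports "Jordan_Normal_Form.Gauss_Jordan_Elimination" "HOL-Analysis.L2_Norm"
begin

definition vec_norm2 :: "complex vec \<Rightarrow> real" where
  "vec_norm2 v = L2_set (\<lambda>i. cmod (v $ i)) {..<dim_vec v}"

text \<open>Meaningful only for an invertible square matrix, where \<open>mat_inverse\<close> is not \<open>None\<close>.\<close>

definition mat_inv :: "'a :: field mat \<Rightarrow> 'a mat" where
  "mat_inv A = the (mat_inverse A)"

definition upper_hessenberg :: "'a :: zero mat \<Rightarrow> bool" where
  "upper_hessenberg H \<longleftrightarrow>
     (\<forall>i < dim_row H. \<forall>j < dim_col H. j + 1 < i \<longrightarrow> H $$ (i, j) = 0)"

text \<open>
  Vectors, shifts and continuation vectors carry the indices of the mathematical text:
  \<open>v 1, \<dots>, v (m + 1)\<close>, \<open>\<sigma> 0, \<dots>, \<sigma> m\<close>, \<open>t 1, \<dots>, t m\<close>.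
  Matrix entries are counted from 0, so the \<open>k\<close>-th vector is column \<open>k - 1\<close>.
\<close>

definition krylov_basis :: "nat \<Rightarrow> (nat \<Rightarrow> complex vec) \<Rightarrow> nat \<Rightarrow> complex mat" where
  "krylov_basis N v k = mat_of_cols N (map v [1..<k + 1])"

definition krylov_w ::
  "nat \<Rightarrow> complex mat \<Rightarrow> complex mat \<Rightarrow> (nat \<Rightarrow> complex) \<Rightarrow> (nat \<Rightarrow> complex vec) \<Rightarrow>
   (nat \<Rightarrow> complex vec) \<Rightarrow> nat \<Rightarrow> complex vec" where
  "krylov_w N A B \<sigma> t v k =
     mat_inv (A - \<sigma> k \<cdot>\<^sub>m B) *\<^sub>v (B *\<^sub>v (krylov_basis N v k *\<^sub>v t k))"

text \<open>
  The outcome of \<open>m\<close> steps of rational Krylov started with \<open>v1\<close>. Since \<open>H\<close> is upper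
  Hessenberg, column \<open>k\<close> of the last equation says that \<open>krylov_w N A B \<sigma> t v k\<close> is a
  combination of \<open>v 1, \<dots>, v (k + 1)\<close>. The subdiagonal entries of \<open>H\<close> may vanish, which
  allows a step in which the new unit vector is not determined by \<open>krylov_w N A B \<sigma> t v k\<close>.
\<close>

definition rational_krylov ::
  "nat \<Rightarrow> complex mat \<Rightarrow> complex mat \<Rightarrow> nat \<Rightarrow> (nat \<Rightarrow> complex) \<Rightarrow> complex vec \<Rightarrow>
   (nat \<Rightarrow> complex vec) \<Rightarrow> (nat \<Rightarrow> complex vec) \<Rightarrow> complex mat \<Rightarrow> bool" where
  "rational_krylov N A B m \<sigma> v1 t v H \<longleftrightarrow>
     v 1 = v1 \<and>
     (\<forall>k \<in> {1..m}. t k \<in> carrier_vec k) \<and>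
     (\<forall>k \<in> {1..m + 1}. v k \<in> carrier_vec N) \<and>
     (\<forall>i \<in> {1..m + 1}. \<forall>j \<in> {1..m + 1}. v i \<bullet>c v j = (if i = j then 1 else 0)) \<and>
     H \<in> carrier_mat (m + 1) m \<and> upper_hessenberg H \<and>
     mat_of_cols N (map (krylov_w N A B \<sigma> t v) [1..<m + 1]) = krylov_basis N v (m + 1) * H"

definition krylov_T :: "nat \<Rightarrow> (nat \<Rightarrow> complex vec) \<Rightarrow> complex mat" where
  "krylov_T m t = mat (m + 1) m (\<lambda>(i, j). if i \<le> j then t (j + 1) $ i else 0)"

definition krylov_K ::
  "nat \<Rightarrow> (nat \<Rightarrow> complex) \<Rightarrow> (nat \<Rightarrow> complex vec) \<Rightarrow> complex mat \<Rightarrow> complex mat" where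
  "krylov_K m \<sigma> t H = H * mat_diag m (\<lambda>j. \<sigma> (j + 1)) + krylov_T m t"

definition precond_residual ::
  "complex mat \<Rightarrow> complex mat \<Rightarrow> complex vec \<Rightarrow> complex \<Rightarrow> complex \<Rightarrow> complex vec \<Rightarrow> complex vec"
  where
  "precond_residual A B d \<sigma>0 \<mu> y =
     mat_inv (A - \<sigma>0 \<cdot>\<^sub>m B) *\<^sub>v (d - (A - \<mu> \<cdot>\<^sub>m B) *\<^sub>v y)"

lemma mat_inv:
  fixes M :: "'a :: field mat"
  assumes M: "M \<in> carrier_mat n n" and inv: "invertible_mat M"
  shows "mat_inv M \<in> carrier_mat n n" "M * mat_inv M = 1\<^sub>m n" "mat_inv M * M = 1\<^sub>m n"
proof -
  obtain C where C: "M * C = 1\<^sub>m (dim_row M)" "C * M = 1\<^sub>m (dim_row C)"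
    using inv unfolding invertible_mat_def inverts_mat_def by auto
  have "dim_col C = n" using arg_cong[OF C(1), of dim_col] M by auto
  moreover have "dim_row C = n" using arg_cong[OF C(2), of dim_col] M by auto
  ultimately have "C \<in> carrier_mat n n" by auto
  then have "M \<in> Units (ring_mat TYPE('a) n ())"
    using C M unfolding Units_def by (auto simp: ring_mat_def intro!: bexI[of _ C])
  then obtain D where "mat_inverse M = Some D"
    using mat_inverse(1)[OF M, where b = "()"] by (cases "mat_inverse M") auto
  with mat_inverse(2)[OF M this]
  show "mat_inv M \<in> carrier_mat n n" "M * mat_inv M = 1\<^sub>m n" "mat_inv M * M = 1\<^sub>m n"
    by (auto simp: mat_inv_def)
qed

lemma rational_krylov_recurrence:
  assumes A: "A \<in> carrier_mat N N" and B: "B \<in> carrier_mat N N"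
    and inv: "\<And>k. k \<in> {1..m} \<Longrightarrow> invertible_mat (A - \<sigma> k \<cdot>\<^sub>m B)"
    and rk: "rational_krylov N A B m \<sigma> v1 t v H"
  shows "A * krylov_basis N v (m + 1) * H =
         B * krylov_basis N v (m + 1) * krylov_K m \<sigma> t H"
proof -
  define V where "V = krylov_basis N v (m + 1)"
  define K where "K = krylov_K m \<sigma> t H"
  define W where "W = mat_of_cols N (map (krylov_w N A B \<sigma> t v) [1..<m + 1])"
  have V: "V \<in> carrier_mat N (m + 1)"
    unfolding V_def krylov_basis_def by (auto simp: mat_of_cols_def)
  have H: "H \<in> carrier_mat (m + 1) m" and WVH: "W = V * H"
    using rk unfolding rational_krylov_def W_def V_def by auto
  have T: "krylov_T m t \<in> carrier_mat (m + 1) m"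
    unfolding krylov_T_def by simp
  have HD: "H * mat_diag m (\<lambda>j. \<sigma> (j + 1)) \<in> carrier_mat (m + 1) m"
    using H by (metis mat_diag_dim mult_carrier_mat)
  have K: "K \<in> carrier_mat (m + 1) m"
    unfolding K_def krylov_K_def using HD T by auto
  have "col (A * V * H) j = col (B * V * K) j" if j: "j < m" for j
  proof -
    let ?k = "j + 1"
    let ?w = "krylov_w N A B \<sigma> t v ?k"
    let ?M = "A - \<sigma> ?k \<cdot>\<^sub>m B"
    let ?u = "krylov_basis N v ?k *\<^sub>v t ?k"
    have k: "?k \<in> {1..m}" using j by auto
    have M: "?M \<in> carrier_mat N N" using A B by auto
    note Mi = mat_inv[OF M inv[OF k]]
    have tk: "t ?k \<in> carrier_vec ?k" using rk k unfolding rational_krylov_def by auto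
    have Vk: "krylov_basis N v ?k \<in> carrier_mat N ?k"
      unfolding krylov_basis_def by (auto simp: mat_of_cols_def)
    have u: "?u \<in> carrier_vec N" using Vk tk by auto
    have w: "?w \<in> carrier_vec N" unfolding krylov_w_def using Mi B u by auto
    have "?M *\<^sub>v ?w = (?M * mat_inv ?M) *\<^sub>v (B *\<^sub>v ?u)"
      unfolding krylov_w_def using assoc_mult_mat_vec[OF M Mi(1)] B u
      by (metis mult_mat_vec_carrier)
    then have Mw: "?M *\<^sub>v ?w = B *\<^sub>v ?u"
      unfolding Mi(2) using B u by auto
    have colW: "col W j = ?w"
      unfolding W_def using j w by (subst col_mat_of_cols) (auto simp del: upt_Suc)
    have colT: "V *\<^sub>v col (krylov_T m t) j = ?u"
    proof (rule eq_vecI)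
      fix i assume "i < dim_vec ?u"
      then have i: "i < N" using Vk by auto
      have "(V *\<^sub>v col (krylov_T m t) j) $ i
          = (\<Sum>l = 0..<m + 1. v (l + 1) $ i * (if l \<le> j then t ?k $ l else 0))"
        using i j V unfolding V_def krylov_basis_def krylov_T_def
        by (auto simp: scalar_prod_def mat_of_cols_def simp del: upt_Suc intro!: sum.cong)
      also have "\<dots> = (\<Sum>l = 0..<?k. v (l + 1) $ i * t ?k $ l)"
        using j by (intro sum.mono_neutral_cong_right) auto
      also have "\<dots> = ?u $ i"
        using i j tk unfolding krylov_basis_def
        by (auto simp: scalar_prod_def mat_of_cols_def simp del: upt_Suc intro!: sum.cong)
      finally show "(V *\<^sub>v col (krylov_T m t) j) $ i = ?u $ i" .
    qed (use V Vk in auto)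
    have colHD: "col (H * mat_diag m (\<lambda>j. \<sigma> (j + 1))) j = \<sigma> ?k \<cdot>\<^sub>v col H j"
      using H j by (subst mat_diag_mult_right[OF H]) (auto simp: mult.commute)
    have VH: "V *\<^sub>v col H j = ?w"
      using colW unfolding WVH col_mult2[OF V H j] .
    have cH: "col H j \<in> carrier_vec (m + 1)" and cT: "col (krylov_T m t) j \<in> carrier_vec (m + 1)"
      using carrier_matD(1)[OF H] carrier_matD(1)[OF T] by (simp_all add: carrier_vecI)
    have "V *\<^sub>v col K j = V *\<^sub>v (\<sigma> ?k \<cdot>\<^sub>v col H j + col (krylov_T m t) j)"
      unfolding K_def krylov_K_def col_add[OF HD T j] colHD ..
    also have "\<dots> = V *\<^sub>v (\<sigma> ?k \<cdot>\<^sub>v col H j) + V *\<^sub>v col (krylov_T m t) j"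
      using cH cT by (intro mult_add_distrib_mat_vec[OF V]) auto
    also have "\<dots> = \<sigma> ?k \<cdot>\<^sub>v ?w + ?u"
      unfolding mult_mat_vec[OF V cH] VH colT ..
    finally have VK: "V *\<^sub>v col K j = \<sigma> ?k \<cdot>\<^sub>v ?w + ?u" .
    have cK: "col K j \<in> carrier_vec (m + 1)" using carrier_matD(1)[OF K] by (simp add: carrier_vecI)
    have BV: "B * V \<in> carrier_mat N (m + 1)" and AV: "A * V \<in> carrier_mat N (m + 1)"
      using A B V by auto
    have "col (B * V * K) j = B *\<^sub>v (V *\<^sub>v col K j)"
      unfolding col_mult2[OF BV K j] assoc_mult_mat_vec[OF B V cK] ..
    also have "\<dots> = B *\<^sub>v (\<sigma> ?k \<cdot>\<^sub>v ?w) + B *\<^sub>v ?u"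
      unfolding VK using w u by (intro mult_add_distrib_mat_vec[OF B]) auto
    also have "\<dots> = \<sigma> ?k \<cdot>\<^sub>v (B *\<^sub>v ?w) + ?M *\<^sub>v ?w"
      unfolding mult_mat_vec[OF B w] Mw ..
    also have "?M *\<^sub>v ?w = A *\<^sub>v ?w - \<sigma> ?k \<cdot>\<^sub>v (B *\<^sub>v ?w)"
    proof -
      have "?M *\<^sub>v x = A *\<^sub>v x - \<sigma> ?k \<cdot>\<^sub>v (B *\<^sub>v x)" if x: "x \<in> carrier_vec N" for x
      proof (rule eq_vecI)
        fix i assume "i < dim_vec (A *\<^sub>v x - \<sigma> ?k \<cdot>\<^sub>v (B *\<^sub>v x))"
        then have "i < N" using B by auto
        then show "(?M *\<^sub>v x) $ i = (A *\<^sub>v x - \<sigma> ?k \<cdot>\<^sub>v (B *\<^sub>v x)) $ i"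
          using A B x
          by (simp add: scalar_prod_def left_diff_distrib sum_subtractf sum_distrib_left mult.assoc)
      qed (use A B in auto)
      then show ?thesis using w .
    qed
    also have "\<sigma> ?k \<cdot>\<^sub>v (B *\<^sub>v ?w) + (A *\<^sub>v ?w - \<sigma> ?k \<cdot>\<^sub>v (B *\<^sub>v ?w)) = A *\<^sub>v ?w"
      using A B by (intro eq_vecI) auto
    also have "\<dots> = col (A * V * H) j"
      unfolding col_mult2[OF AV H j] assoc_mult_mat_vec[OF A V cH] VH ..
    finally show ?thesis by simp
  qed
  then have "A * V * H = B * V * K"
    using A B V H K by (intro mat_col_eqI) auto
  then show ?thesis unfolding V_def K_def .
qed

end

theory Submission
  imports Defs
begin

text \<open>
  Write \<open>M = A - \<sigma>\<^sub>0 B\<close>. The recurrence \<open>A V H = B V K\<close> lets the two shifts \<open>\<sigma>\<^sub>0\<close> and \<open>\<mu>\<close>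
  change places: \<open>(A - \<mu> B) V (K - \<sigma>\<^sub>0 H) = (A - \<sigma>\<^sub>0 B) V (K - \<mu> H)\<close>, because after expanding
  both sides the four terms agree except for the two mixed ones, which the recurrence identifies
  (\<open>pencil_shift_exchange\<close>). Multiplication by the inverse of \<open>M\<close> therefore turns the residual of
  \<open>V (K - \<sigma>\<^sub>0 H) y\<close> into \<open>dhat - V (K - \<mu> H) y\<close>. The starting vector is \<open>dhat / \<beta>\<close>, so \<open>dhat\<close>
  is the image under \<open>V\<close> of \<open>\<beta>\<close> times the first unit vector, and the preconditioned residual is the
  image under \<open>V\<close> of the residual of the small least-squares problem. The columns of \<open>V\<close> are
  orthonormal and \<open>V\<close> preserves the norm (\<open>vec_norm2_mult_orthonormal_cols\<close>): the two objective
  functions have equal values at corresponding points, so a minimizer of the small problem yields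
  one of the large problem.
\<close>

lemma vec_norm2_eq_0_iff:
  assumes "x \<in> carrier_vec n"
  shows "vec_norm2 x = 0 \<longleftrightarrow> x = 0\<^sub>v n"
  using assms by (auto simp: vec_norm2_def L2_set_eq_0_iff intro!: eq_vecI)

lemma vec_norm2_square_cscalar_prod:
  "complex_of_real ((vec_norm2 x)\<^sup>2) = x \<bullet>c x"
proof -
  have "(vec_norm2 x)\<^sup>2 = (\<Sum>i<dim_vec x. (cmod (x $ i))\<^sup>2)"
    unfolding vec_norm2_def L2_set_def by (intro real_sqrt_pow2 sum_nonneg) auto
  then show ?thesis
    by (auto simp: scalar_prod_def lessThan_atLeast0 complex_norm_square
        simp del: of_real_power intro!: sum.cong)
qed

text \<open>
  The squared norm of \<open>V x\<close> is the quadratic form in \<open>x\<close> of the Gram matrix of the columns of \<open>V\<close>,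
  and that matrix is the identity.
\<close>

lemma vec_norm2_mult_orthonormal_cols:
  assumes V: "V \<in> carrier_mat N n" and x: "x \<in> carrier_vec n"
    and orth: "\<And>k l. k < n \<Longrightarrow> l < n \<Longrightarrow> col V k \<bullet>c col V l = (if k = l then 1 else 0)"
  shows "vec_norm2 (V *\<^sub>v x) = vec_norm2 x"
proof -
  have orth': "(\<Sum>i<N. V $$ (i, k) * cnj (V $$ (i, l))) = (if k = l then 1 else 0)"
    if "k < n" "l < n" for k l
    using orth[OF that] V that by (simp add: scalar_prod_def lessThan_atLeast0)
  have "(V *\<^sub>v x) \<bullet>c (V *\<^sub>v x)
      = (\<Sum>i<N. (\<Sum>k<n. V $$ (i, k) * x $ k) * (\<Sum>l<n. cnj (V $$ (i, l)) * cnj (x $ l)))"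
    using V x by (simp add: scalar_prod_def lessThan_atLeast0)
  also have "\<dots> = (\<Sum>i<N. \<Sum>k<n. \<Sum>l<n. x $ k * cnj (x $ l) * (V $$ (i, k) * cnj (V $$ (i, l))))"
    by (simp add: sum_product mult_ac)
  also have "\<dots> = (\<Sum>k<n. \<Sum>i<N. \<Sum>l<n. x $ k * cnj (x $ l) * (V $$ (i, k) * cnj (V $$ (i, l))))"
    by (rule sum.swap)
  also have "\<dots> = (\<Sum>k<n. \<Sum>l<n. x $ k * cnj (x $ l) * (\<Sum>i<N. V $$ (i, k) * cnj (V $$ (i, l))))"
    unfolding sum_distrib_left by (intro sum.cong refl sum.swap)
  also have "\<dots> = (\<Sum>k<n. \<Sum>l<n. if k = l then x $ k * cnj (x $ l) else 0)"
    using orth' by (intro sum.cong refl) auto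
  also have "\<dots> = x \<bullet>c x"
    using x by (simp add: scalar_prod_def lessThan_atLeast0)
  finally have "complex_of_real ((vec_norm2 (V *\<^sub>v x))\<^sup>2) = complex_of_real ((vec_norm2 x)\<^sup>2)"
    unfolding vec_norm2_square_cscalar_prod .
  then have "(vec_norm2 (V *\<^sub>v x))\<^sup>2 = (vec_norm2 x)\<^sup>2"
    by (simp only: of_real_eq_iff)
  then show ?thesis
    by (rule power2_eq_imp_eq) (simp_all add: vec_norm2_def)
qed

lemma pencil_mult_vec:
  fixes X Y :: "'a :: comm_ring_1 mat"
  assumes "X \<in> carrier_mat r c" "Y \<in> carrier_mat r c" "x \<in> carrier_vec c"
  shows "(X - s \<cdot>\<^sub>m Y) *\<^sub>v x = X *\<^sub>v x - s \<cdot>\<^sub>v (Y *\<^sub>v x)"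
  using assms
  by (intro eq_vecI)
    (auto simp: scalar_prod_def left_diff_distrib sum_subtractf sum_distrib_left mult.assoc)

lemma mult_mat_vec_pencil:
  fixes X :: "'a :: comm_ring_1 mat"
  assumes "X \<in> carrier_mat r c" "p \<in> carrier_vec c" "q \<in> carrier_vec c"
  shows "X *\<^sub>v (p - s \<cdot>\<^sub>v q) = X *\<^sub>v p - s \<cdot>\<^sub>v (X *\<^sub>v q)"
  using assms
  by (intro eq_vecI)
    (auto simp: scalar_prod_def right_diff_distrib sum_subtractf sum_distrib_left mult_ac)

text \<open>
  Both sides expand to \<open>A V K y - (s + u) A V H y + s u B V H y\<close>: each has the mixed terms
  \<open>A V H y\<close> and \<open>B V K y\<close>, one with coefficient \<open>- s\<close> and the other with \<open>- u\<close>, and the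
  recurrence makes these two vectors equal.
\<close>

lemma pencil_shift_exchange:
  fixes A B V H K :: "'a :: comm_ring_1 mat"
  assumes A: "A \<in> carrier_mat N N" and B: "B \<in> carrier_mat N N"
    and V: "V \<in> carrier_mat N n" and H: "H \<in> carrier_mat n m" and K: "K \<in> carrier_mat n m"
    and y: "y \<in> carrier_vec m"
    and rec: "A * V * H = B * V * K"
  shows "(A - u \<cdot>\<^sub>m B) *\<^sub>v (V *\<^sub>v ((K - s \<cdot>\<^sub>m H) *\<^sub>v y))
       = (A - s \<cdot>\<^sub>m B) *\<^sub>v (V *\<^sub>v ((K - u \<cdot>\<^sub>m H) *\<^sub>v y))"
proof -
  define p where "p = V *\<^sub>v (K *\<^sub>v y)"
  define h where "h = V *\<^sub>v (H *\<^sub>v y)"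
  have p: "p \<in> carrier_vec N" and h: "h \<in> carrier_vec N"
    using V K H y by (auto simp: p_def h_def)
  have "A *\<^sub>v h = (A * V * H) *\<^sub>v y" and "B *\<^sub>v p = (B * V * K) *\<^sub>v y"
    unfolding p_def h_def assoc_mult_mat_vec[OF mult_carrier_mat[OF A V] H y]
      assoc_mult_mat_vec[OF mult_carrier_mat[OF B V] K y]
      assoc_mult_mat_vec[OF A V mult_mat_vec_carrier[OF H y]]
      assoc_mult_mat_vec[OF B V mult_mat_vec_carrier[OF K y]] by simp_all
  then have q: "A *\<^sub>v h = B *\<^sub>v p"
    using rec by simp
  have expand: "V *\<^sub>v ((K - a \<cdot>\<^sub>m H) *\<^sub>v y) = p - a \<cdot>\<^sub>v h" for a
    using V H K y by (simp add: pencil_mult_vec[OF K H y] mult_mat_vec_pencil[OF V] p_def h_def)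
  have Ap: "A *\<^sub>v p \<in> carrier_vec N" and Bp: "B *\<^sub>v p \<in> carrier_vec N"
    and Bh: "B *\<^sub>v h \<in> carrier_vec N"
    using A B p h by auto
  have "(A - a \<cdot>\<^sub>m B) *\<^sub>v (p - b \<cdot>\<^sub>v h)
      = (A *\<^sub>v p - b \<cdot>\<^sub>v (B *\<^sub>v p)) - a \<cdot>\<^sub>v (B *\<^sub>v p - b \<cdot>\<^sub>v (B *\<^sub>v h))" for a b
    using p h by (simp add: pencil_mult_vec[OF A B] mult_mat_vec_pencil[OF A]
        mult_mat_vec_pencil[OF B] q)
  then show ?thesis
    unfolding expand using Ap Bp Bh by (intro eq_vecI) (auto simp: algebra_simps)
qed

lemma krylov_basis_carrier: "krylov_basis N v k \<in> carrier_mat N k"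
  by (auto simp: krylov_basis_def mat_of_cols_def)

lemma col_krylov_basis:
  assumes "v (j + 1) \<in> carrier_vec N" and "j < k"
  shows "col (krylov_basis N v k) j = v (j + 1)"
  unfolding krylov_basis_def using assms
  by (subst col_mat_of_cols) (auto simp del: upt_Suc)

lemma rational_krylov_orthonormal_cols:
  assumes rk: "rational_krylov N A B m \<sigma> v1 t v H" and "k < m + 1" "l < m + 1"
  shows "col (krylov_basis N v (m + 1)) k \<bullet>c col (krylov_basis N v (m + 1)) l
       = (if k = l then 1 else 0)"
proof -
  have "v (j + 1) \<in> carrier_vec N" if "j < m + 1" for j
    using rk that by (simp add: rational_krylov_def)
  then show ?thesis
    using rk assms(2,3) by (simp add: col_krylov_basis rational_krylov_def)
qed

lemma krylov_K_carrier:
  assumes "H \<in> carrier_mat (m + 1) m"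
  shows "krylov_K m \<sigma> t H \<in> carrier_mat (m + 1) m"
  using assms mult_carrier_mat[OF assms mat_diag_dim]
  by (auto simp: krylov_K_def krylov_T_def)

text \<open>
  The bridge between the large and the small problem: on the search space, the preconditioned
  residual is the residual of the projected least-squares problem, expressed in the basis \<open>V\<close>.
\<close>

lemma precond_residual_krylov:
  assumes A: "A \<in> carrier_mat N N" and B: "B \<in> carrier_mat N N" and d: "d \<in> carrier_vec N"
    and inv: "\<And>i. i \<in> {0..m} \<Longrightarrow> invertible_mat (A - \<sigma> i \<cdot>\<^sub>m B)"
    and dhat: "dhat = mat_inv (A - \<sigma> 0 \<cdot>\<^sub>m B) *\<^sub>v d" "dhat \<noteq> 0\<^sub>v N"
    and \<beta>: "\<beta> = vec_norm2 dhat"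
    and rk: "rational_krylov N A B m \<sigma> (complex_of_real (1 / \<beta>) \<cdot>\<^sub>v dhat) t v H"
    and V_eq: "V = krylov_basis N v (m + 1)" and K_eq: "K = krylov_K m \<sigma> t H"
    and y: "y \<in> carrier_vec m"
  shows "precond_residual A B d (\<sigma> 0) \<mu> (V *\<^sub>v ((K - \<sigma> 0 \<cdot>\<^sub>m H) *\<^sub>v y))
       = V *\<^sub>v (complex_of_real \<beta> \<cdot>\<^sub>v unit_vec (m + 1) 0 - (K - \<mu> \<cdot>\<^sub>m H) *\<^sub>v y)"
proof -
  define M where "M = A - \<sigma> 0 \<cdot>\<^sub>m B"
  define x where "x = (K - \<mu> \<cdot>\<^sub>m H) *\<^sub>v y"
  have M: "M \<in> carrier_mat N N" and "invertible_mat M"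
    using A B inv by (auto simp: M_def)
  note Mi = mat_inv[OF this]
  have V: "V \<in> carrier_mat N (m + 1)"
    unfolding V_eq by (rule krylov_basis_carrier)
  have H: "H \<in> carrier_mat (m + 1) m"
    using rk by (simp add: rational_krylov_def)
  then have K: "K \<in> carrier_mat (m + 1) m"
    unfolding K_eq by (rule krylov_K_carrier)
  have x: "x \<in> carrier_vec (m + 1)"
    using H K y unfolding x_def by (intro mult_mat_vec_carrier[of _ _ m] minus_carrier_mat) auto
  have dh: "dhat \<in> carrier_vec N"
    using Mi(1) d by (auto simp: dhat(1) M_def)
  have "A * V * H = B * V * K"
    unfolding V_eq K_eq using rational_krylov_recurrence[OF A B _ rk] inv by simp
  then have "(A - \<mu> \<cdot>\<^sub>m B) *\<^sub>v (V *\<^sub>v ((K - \<sigma> 0 \<cdot>\<^sub>m H) *\<^sub>v y)) = M *\<^sub>v (V *\<^sub>v x)"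
    unfolding M_def x_def by (rule pencil_shift_exchange[OF A B V H K y])
  then have "precond_residual A B d (\<sigma> 0) \<mu> (V *\<^sub>v ((K - \<sigma> 0 \<cdot>\<^sub>m H) *\<^sub>v y))
      = mat_inv M *\<^sub>v (d - M *\<^sub>v (V *\<^sub>v x))"
    by (simp add: precond_residual_def M_def)
  also have "\<dots> = mat_inv M *\<^sub>v d - mat_inv M *\<^sub>v (M *\<^sub>v (V *\<^sub>v x))"
    using M V x d by (intro mult_minus_distrib_mat_vec[OF Mi(1)]) auto
  also have "mat_inv M *\<^sub>v (M *\<^sub>v (V *\<^sub>v x)) = V *\<^sub>v x"
    using V x by (simp add: assoc_mult_mat_vec[OF Mi(1) M, symmetric] Mi(3))
  also have "mat_inv M *\<^sub>v d = V *\<^sub>v (complex_of_real \<beta> \<cdot>\<^sub>v unit_vec (m + 1) 0)"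
  proof -
    have "\<beta> \<noteq> 0"
      using dhat(2) vec_norm2_eq_0_iff[OF dh] \<beta> by simp
    have "V *\<^sub>v unit_vec (m + 1) 0 = col V 0"
      using V by (intro eq_vecI) auto
    also have "\<dots> = complex_of_real (1 / \<beta>) \<cdot>\<^sub>v dhat"
      using rk dh col_krylov_basis[of v 0 N "m + 1"] by (simp add: V_eq rational_krylov_def)
    finally have "V *\<^sub>v unit_vec (m + 1) 0 = complex_of_real (1 / \<beta>) \<cdot>\<^sub>v dhat" .
    then have "V *\<^sub>v (complex_of_real \<beta> \<cdot>\<^sub>v unit_vec (m + 1) 0) = dhat"
      using \<open>\<beta> \<noteq> 0\<close> by (simp add: mult_mat_vec[OF V] smult_smult_assoc)
    then show ?thesis
      by (simp add: dhat(1) M_def)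
  qed
  also have "V *\<^sub>v (complex_of_real \<beta> \<cdot>\<^sub>v unit_vec (m + 1) 0) - V *\<^sub>v x
      = V *\<^sub>v (complex_of_real \<beta> \<cdot>\<^sub>v unit_vec (m + 1) 0 - x)"
    using x by (intro mult_minus_distrib_mat_vec[OF V, symmetric]) auto
  finally show ?thesis
    unfolding x_def .
qed

theorem proposition2p2:
  fixes N m :: nat
    and A B H K V :: "complex mat"
    and d dhat yred ym :: "complex vec"
    and \<mu> :: complex
    and \<sigma> :: "nat \<Rightarrow> complex"
    and t v :: "nat \<Rightarrow> complex vec"
    and \<beta> :: real
  assumes "A \<in> carrier_mat N N" and "B \<in> carrier_mat N N" and "d \<in> carrier_vec N"
    and "\<And>i. i \<in> {0..m} \<Longrightarrow> invertible_mat (A - \<sigma> i \<cdot>\<^sub>m B)"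
    and "dhat = mat_inv (A - \<sigma> 0 \<cdot>\<^sub>m B) *\<^sub>v d" and "dhat \<noteq> 0\<^sub>v N"
    and "\<beta> = vec_norm2 dhat"
    and "rational_krylov N A B m \<sigma> (complex_of_real (1 / \<beta>) \<cdot>\<^sub>v dhat) t v H"
    and "V = krylov_basis N v (m + 1)"
    and "K = krylov_K m \<sigma> t H"
    and "is_arg_min
           (\<lambda>y. vec_norm2 (complex_of_real \<beta> \<cdot>\<^sub>v unit_vec (m + 1) 0 - (K - \<mu> \<cdot>\<^sub>m H) *\<^sub>v y))
           (\<lambda>y. y \<in> carrier_vec m) yred"
    and "ym = V *\<^sub>v ((K - \<sigma> 0 \<cdot>\<^sub>m H) *\<^sub>v yred)"
  shows "is_arg_min (\<lambda>z. vec_norm2 (precond_residual A B d (\<sigma> 0) \<mu> z))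
           (\<lambda>z. z \<in> {V *\<^sub>v ((K - \<sigma> 0 \<cdot>\<^sub>m H) *\<^sub>v y) | y. y \<in> carrier_vec m}) ym
       \<and> vec_norm2 (precond_residual A B d (\<sigma> 0) \<mu> ym)
         = vec_norm2 (complex_of_real \<beta> \<cdot>\<^sub>v unit_vec (m + 1) 0 - (K - \<mu> \<cdot>\<^sub>m H) *\<^sub>v yred)"
proof -
  let ?S = "\<lambda>y. V *\<^sub>v ((K - \<sigma> 0 \<cdot>\<^sub>m H) *\<^sub>v y)"
  let ?r = "\<lambda>z. vec_norm2 (precond_residual A B d (\<sigma> 0) \<mu> z)"
  let ?f = "\<lambda>y. vec_norm2 (complex_of_real \<beta> \<cdot>\<^sub>v unit_vec (m + 1) 0 - (K - \<mu> \<cdot>\<^sub>m H) *\<^sub>v y)"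
  have V: "V \<in> carrier_mat N (m + 1)"
    unfolding assms(9) by (rule krylov_basis_carrier)
  have H: "H \<in> carrier_mat (m + 1) m"
    using assms(8) by (simp add: rational_krylov_def)
  have norms: "?r (?S y) = ?f y" if y: "y \<in> carrier_vec m" for y
  proof -
    have residual: "precond_residual A B d (\<sigma> 0) \<mu> (?S y)
        = V *\<^sub>v (complex_of_real \<beta> \<cdot>\<^sub>v unit_vec (m + 1) 0 - (K - \<mu> \<cdot>\<^sub>m H) *\<^sub>v y)"
      using precond_residual_krylov[OF assms(1-3) _ assms(5-10) y] assms(4) by blast
    have "complex_of_real \<beta> \<cdot>\<^sub>v unit_vec (m + 1) 0 - (K - \<mu> \<cdot>\<^sub>m H) *\<^sub>v y \<in> carrier_vec (m + 1)"
      using H y by (intro minus_carrier_vec mult_mat_vec_carrier[of _ _ m] minus_carrier_mat) auto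
    then show ?thesis
      unfolding residual
      using V rational_krylov_orthonormal_cols[OF assms(8)]
      by (intro vec_norm2_mult_orthonormal_cols) (auto simp: assms(9))
  qed
  have yred: "yred \<in> carrier_vec m"
    and min: "\<And>y. y \<in> carrier_vec m \<Longrightarrow> \<not> ?f y < ?f yred"
    using assms(11) by (auto simp: is_arg_min_def)
  show ?thesis
    using yred min norms unfolding assms(12) is_arg_min_def by auto
qed

end
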